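(* Let $\ell>0$ and let $p=(u,v):\mathbb{R}\to\mathbb{R}^2$ be a smooth map with $u(s+\ell)=2\pi+u(s)$, $v(s+\ell)=v(s)$ and $u'(s)^2+v'(s)^2=1$ for all $s\in\mathbb{R}$. Let $\gamma=\{p(s):s\in\mathbb{R}\}$, and let $\vartheta:\mathbb{R}\to\mathbb{R}$ be a smooth function with $p'(s)=(\cos\vartheta(s),\sin\vartheta(s))$ for all $s\in\mathbb{R}$. Suppose that all crossings of $\gamma$ are simple. Then: (a) If $p$ is injective on every interval of length $\ell-2\pi$, then $p$ is injective (on $\mathbb{R}$). (b) If $p$ is not injective, then the curvature of $\gamma$ is somewhere at least $2\pi/(\ell-2\pi)$, i.e. there exists $s\in\mathbb{R}$ with $|\vartheta'(s)|\ge 2\pi/(\ell-2\pi)$. (c) If $p$ is not injective and $\vartheta$ is periodic with period $\ell$ (i.e. $\vartheta(s+\ell)=\vartheta(s)$ for all $s$), then $\gamma$ has a periodic segment which contains two crossings; that is, there exist $a\in\mathbb{R}$ and two distinct points $q_1\ne q_2$ in $\mathbb{R}^2$ such that, for each $i\in\{1,2\}$, $q_i=p(s_i)=p(t_i)$ for some $s_i\neq t_i$ in $[a,a+\ell]$.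
   Context: Smooth means $C^\infty$. The curve $\gamma$ is parametrized by arc length and $\ell$ is the length of one period. A point $q\in\gamma$ is called a crossing of $\gamma$ if $q=p(s_1)=p(s_2)$ for some $s_1\neq s_2$ in $\mathbb{R}$. A crossing $q$ is called simple if there are exactly two real numbers $s_1\neq s_2$ with $p(s_1)=p(s_2)=q$, and for these $p'(s_1)\neq\pm p'(s_2)$ (the two branches cross transversally). A periodic segment of $\gamma$ is a segment of the form $\{p(t):t\in[a,a+\ell]\}$ with $a\in\mathbb{R}$. The curvature of $\gamma$ at $p(s)$ is understood as the absolute value $|\vartheta'(s)|$. (A horizontal line has $\ell=2\pi$ and $p$ injective; if $p$ is not injective then $\ell>2\pi$.) *)

theory Defs
  imports "HOL-Analysis.Analysis"
begin

definition smooth :: "(real \<Rightarrow> 'a::real_normed_vector) \<Rightarrow> bool" where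
  "smooth f \<longleftrightarrow>
     (\<forall>n s. ((\<lambda>g t. vector_derivative g (at t)) ^^ n) f differentiable (at s))"

definition crossing :: "(real \<Rightarrow> real \<times> real) \<Rightarrow> real \<times> real \<Rightarrow> bool" where
  "crossing p q \<longleftrightarrow> (\<exists>s1 s2. s1 \<noteq> s2 \<and> p s1 = q \<and> p s2 = q)"

definition simple_crossing :: "(real \<Rightarrow> real \<times> real) \<Rightarrow> real \<times> real \<Rightarrow> bool" where
  "simple_crossing p q \<longleftrightarrow>
     (\<exists>s1 s2. s1 \<noteq> s2 \<and> {s. p s = q} = {s1, s2} \<and>
        vector_derivative p (at s1) \<noteq> vector_derivative p (at s2) \<and>
        vector_derivative p (at s1) \<noteq> - vector_derivative p (at s2))"

end

theory Submission
  imports Defs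
begin

text \<open>Call x < y a loop if \<open>P x = P y\<close>. The main device is a continuous angle of
  the chord P y - P x over a region of pairs (x, y). It exists on convex regions without loops
  (\<open>angle_lift\<close>), continues to the diagonal as the tangent angle
  (\<open>tangent_angle_lift\<close>), and cannot change branch while the chord stays in a half
  plane (\<open>lift_stays_in_halfplane\<close>).

  If the curve is not injective, it has a loop shorter than a period
  (\<open>ex_loop_shorter_than_period\<close>). Otherwise a shortest loop meets a highest and a
  lowest point of the curve. There the chords from its base point and back to it, which are
  opposite, have angles whose difference is a constant odd multiple of \<pi>, yet is both
  nonnegative and nonpositive. The arc completing a loop shorter than a period joins points at
  distance 2\<pi>, so the loop has length at most L - 2\<pi> (\<open>ex_short_loop\<close>); this is
  (a). Comparing the loop with a circle of the same length (\<open>loop_curvature\<close>) gives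
  (b).

  For (c), cut the curve at the corner of such a loop. Without further loops, the periodic remainder
  has rotation number 0 and the loop has rotation number 1 or -1, which place the tangent angles at
  the corner on the same branch and on different branches of one half plane. Hence there is a second
  loop within one period (\<open>ex_second_loop\<close>). It is a different crossing, because a
  simple crossing is passed only twice.\<close>

subsection \<open>Lifting angles\<close>

text \<open>A nonvanishing map on a convex, hence contractible, set has a continuous logarithm. Its
  imaginary part is shifted by a constant to take the value \<open>c\<close> at
  \<open>z0\<close>.\<close>

lemma angle_lift:
  fixes G :: "'a::real_normed_vector \<Rightarrow> complex" and c :: real
  assumes S: "convex S" and G: "continuous_on S G" "\<And>z. z \<in> S \<Longrightarrow> G z \<noteq> 0"
    and z0: "z0 \<in> S" "G z0 = of_real (norm (G z0)) * cis c"
  shows "\<exists>\<phi>. continuous_on S \<phi> \<and> \<phi> z0 = c \<and>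
    (\<forall>z\<in>S. G z = of_real (norm (G z)) * cis (\<phi> z))"
proof -
  obtain g where g: "continuous_on S g" "\<And>z. z \<in> S \<Longrightarrow> G z = exp (g z)"
    using continuous_logarithm_on_contractible[OF G(1) convex_imp_contractible[OF S] G(2)] by metis
  define \<phi> where "\<phi> z = Im (g z) - Im (g z0) + c" for z
  have polar: "G z = of_real (norm (G z)) * cis (Im (g z))" if "z \<in> S" for z
    using g(2)[OF that] by (metis exp_eq_polar norm_exp_eq_Re)
  have eq: "cis (Im (g z0)) = cis c"
    using polar[OF z0(1)] z0(2) G(2)[OF z0(1)]
    by (metis mult_cancel_left norm_eq_zero of_real_eq_0_iff)
  have "cis (\<phi> z) = cis (Im (g z))" for z
    unfolding \<phi>_def by (simp add: eq flip: cis_mult cis_divide)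
  moreover have "continuous_on S \<phi>"
    unfolding \<phi>_def by (intro continuous_intros g(1))
  ultimately show ?thesis
    using polar by (intro exI[of _ \<phi>]) (simp add: \<phi>_def)
qed

text \<open>Any two distinct values of \<open>f\<close> differ by at least 2\<pi>, so its range is
  discrete.\<close>

lemma cis_const_imp_const:
  fixes f :: "'a::topological_space \<Rightarrow> real"
  assumes "connected T" "continuous_on T f" "\<And>z. z \<in> T \<Longrightarrow> cis (f z) = c" "x \<in> T" "y \<in> T"
  shows "f x = f y"
proof -
  have "f constant_on T"
  proof (rule continuous_discrete_range_constant[OF assms(1,2)])
    fix x assume x: "x \<in> T"
    show "\<exists>e>0. \<forall>y. y \<in> T \<and> f y \<noteq> f x \<longrightarrow> e \<le> norm (f y - f x)"
    proof (intro exI[of _ "2 * pi"] conjI allI impI)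
      fix y assume y: "y \<in> T \<and> f y \<noteq> f x"
      have "cis (f y - f x) = 1"
        using assms(3)[OF x] assms(3)[of y] y by (metis cis_divide cis_neq_zero divide_self)
      then have "cos (f y - f x) = 1"
        by (metis cis.sel(1) one_complex.sel(1))
      then obtain k :: int where k: "f y - f x = of_int k * 2 * pi"
        using cos_one_2pi_int by blast
      then have "\<bar>of_int k :: real\<bar> \<ge> 1" using y by (cases "k = 0") auto
      then show "2 * pi \<le> norm (f y - f x)"
        using k by (simp add: abs_mult)
    qed simp
  qed
  then show ?thesis using assms(4,5) unfolding constant_on_def by metis
qed

text \<open>The angles with nonnegative cosine form closed intervals separated by gaps, and a
  connected image cannot jump a gap.\<close>

lemma lift_stays_in_halfplane:
  fixes f :: "'a::topological_space \<Rightarrow> real"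
  assumes "connected T" "continuous_on T f" "\<And>z. z \<in> T \<Longrightarrow> cos (f z - \<alpha>) \<ge> 0"
    and "x \<in> T" "\<bar>f x - \<alpha>\<bar> \<le> pi / 2" "y \<in> T"
  shows "\<bar>f y - \<alpha>\<bar> \<le> pi / 2"
proof (rule ccontr)
  have conn: "connected (f ` T)" by (rule connected_continuous_image[OF assms(2,1)])
  have fx: "f x \<le> \<alpha> + pi / 2" "f x \<ge> \<alpha> - pi / 2"
    using assms(5) by linarith+
  assume "\<not> ?thesis"
  then consider "f y > \<alpha> + pi / 2" | "f y < \<alpha> - pi / 2" by linarith
  then show False
  proof cases
    case 1
    \<comment> \<open>Either \<open>f y\<close> is already in the gap or its midpoint \<alpha> +
      \<pi> is attained on the way.\<close>
    define w where "w = min (f y) (\<alpha> + pi)"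
    have "w \<in> f ` T"
      by (rule connectedD_interval[OF conn, of "f x" "f y"])
        (use 1 fx pi_gt_zero assms(4,6) in \<open>auto simp only: w_def min_def imageI split: if_splits\<close>)
    then have "cos (w - \<alpha>) \<ge> 0" using assms(3) by auto
    moreover have "cos (pi - (w - \<alpha>)) > 0"
      by (rule cos_gt_zero_pi) (use 1 pi_gt_zero in \<open>auto simp: w_def min_def simp del: pi_gt_zero\<close>)
    ultimately show False by (simp add: cos_diff)
  next
    case 2
    define w where "w = max (f y) (\<alpha> - pi)"
    have "w \<in> f ` T"
      by (rule connectedD_interval[OF conn, of "f y" "f x"])
        (use 2 fx pi_gt_zero assms(4,6) in \<open>auto simp only: w_def max_def imageI split: if_splits\<close>)
    then have "cos (w - \<alpha>) \<ge> 0" using assms(3) by auto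
    moreover have "cos (pi + (w - \<alpha>)) > 0"
      by (rule cos_gt_zero_pi) (use 2 pi_gt_zero in \<open>auto simp: w_def max_def simp del: pi_gt_zero\<close>)
    ultimately show False by (simp add: cos_add)
  qed
qed

lemma cis_of_polar_neg:
  assumes "z = of_real r * cis a" "- z = of_real r * cis b" "z \<noteq> 0"
  shows "cis (a - b) = -1"
proof -
  have "of_real r * cis a = of_real r * (- cis b)" "r \<noteq> 0"
    using assms by (metis minus_equation_iff mult_minus_right, auto)
  then have "cis a = - cis b" by (metis mult_cancel_left of_real_eq_0_iff)
  then show ?thesis by (simp add: cis_neq_zero flip: cis_divide)
qed

lemma cis_of_polar_eq:
  assumes "z = of_real r * cis a" "z = of_real r * cis b" "z \<noteq> 0"
  shows "cis (a - b) = 1"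
proof -
  have "cis a = cis b" using assms by (metis mult_cancel_left mult_zero_left of_real_eq_0_iff)
  then show ?thesis by (simp add: cis_neq_zero flip: cis_divide)
qed

lemma cis_of_polar_pos:
  assumes "of_real c = of_real (cmod (of_real c)) * cis a" "c > 0"
  shows "cis a = 1"
  using assms by simp

subsection \<open>Loops shorter than a period\<close>

lemma period_shift_int:
  fixes f :: "real \<Rightarrow> 'a::real_vector"
  assumes "\<And>s. f (s + L) = f s + c"
  shows "f (s + of_int k * L) = f s + of_int k *\<^sub>R c"
proof (induction k rule: int_induct[where k = 0])
  case (step1 i)
  then show ?case using assms[of "s + of_int i * L"] by (simp add: algebra_simps)
next
  case (step2 i)
  then show ?case using assms[of "s + (of_int i - 1) * L"] by (simp add: algebra_simps)
qed simp

lemma period_representative: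
  fixes L :: real
  assumes "L > 0"
  obtains k :: int where "a < s + of_int k * L" "s + of_int k * L \<le> a + L"
proof
  define k where "k = - \<lceil>(s - a) / L\<rceil> + 1"
  have "(s - a) / L \<le> of_int \<lceil>(s - a) / L\<rceil>" "of_int \<lceil>(s - a) / L\<rceil> < (s - a) / L + 1"
    by linarith+
  then have "s - a \<le> of_int \<lceil>(s - a) / L\<rceil> * L" "of_int \<lceil>(s - a) / L\<rceil> * L < s - a + L"
    using mult_right_mono[of "(s - a) / L" _ L] mult_strict_right_mono[of _ "(s - a) / L + 1" L] assms
    by (simp_all add: distrib_right)
  then show "a < s + of_int k * L" "s + of_int k * L \<le> a + L"
    by (simp_all add: k_def algebra_simps)
qed

text \<open>The half-open interval makes the maximum point interior to any loop based at
  \<open>a\<close> that is longer than \<open>L\<close>.\<close>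

lemma periodic_attains_max:
  fixes f :: "real \<Rightarrow> real"
  assumes "continuous_on UNIV f" "L > 0" "\<And>s. f (s + L) = f s"
  obtains t where "a < t" "t \<le> a + L" "\<And>s. f s \<le> f t"
proof -
  have "compact {a..a + L}" "{a..a + L} \<noteq> {}" "continuous_on {a..a + L} f"
    using assms continuous_on_subset[OF assms(1)] by auto
  then obtain t0 where t0: "t0 \<in> {a..a + L}" "\<And>s. s \<in> {a..a + L} \<Longrightarrow> f s \<le> f t0"
    using continuous_attains_sup by metis
  have shift: "f (s + of_int k * L) = f s" for s k
    using period_shift_int[of f L 0 s k] assms(3) by simp
  have max: "f s \<le> f t0" for s
  proof -
    obtain k where "a < s + of_int k * L" "s + of_int k * L \<le> a + L"
      using period_representative[OF assms(2)] by metis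
    then show ?thesis using t0(2)[of "s + of_int k * L"] shift by simp
  qed
  show thesis
  proof (cases "t0 = a")
    case True
    then show thesis using that[of "a + L"] max assms(2,3) by simp
  next
    case False
    then show thesis using that[of t0] max t0(1) by simp
  qed
qed

text \<open>Take a shortest loop and suppose that it is longer than a period. Then a global maximum and a
  global minimum of the height lie on it. The lifted direction of \<open>P y - P x\<close>, normalised to \<open>0\<close>
  at \<open>y = x + L\<close>, is defined for all chords shorter than the loop, and at the extreme points it is
  confined to half planes. For \<open>y\<close> on the loop, the chords from the base point to \<open>y\<close> and from \<open>y\<close>
  to the base point are opposite, so their lifted directions differ by a constant odd multiple
  of \<open>\<pi>\<close>; but it is positive at the maximum and negative at the minimum.\<close>

lemma ex_loop_shorter_than_period:
  fixes P :: "real \<Rightarrow> complex"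
  assumes cont: "continuous_on UNIV P" and L: "L > 0" and c: "c > 0"
    and per: "\<And>s. P (s + L) = P s + of_real c"
    and loop: "P s = P t" "s < t"
  obtains x y where "x < y" "y < x + L" "P x = P y"
proof (rule ccontr)
  note found = that
  assume "\<not> thesis"
  then have no_short: "P x \<noteq> P y" if "x < y" "y < x + L" for x y
    using found that by blast
  have no_period: "P x \<noteq> P (x + L)" for x using per[of x] c by simp
  have shift: "P (s + of_int k * L) = P s + of_real (of_int k * c)" for s k
    using period_shift_int[of P L "of_real c" s k] per by (simp add: scaleR_conv_of_real)

  \<comment> \<open>Loops are stored as base point and length; periodicity and the bound t - s make
    this set compact, so a shortest loop exists.\<close>
  define K where "K = ({0..L} \<times> {L..t - s}) \<inter> {z. P (fst z + snd z) = P (fst z)}"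
  have "compact K"
    unfolding K_def
    by (intro compact_Int_closed compact_Times compact_Icc closed_Collect_eq
        continuous_on_compose2[OF cont] continuous_intros) auto
  have representative: "\<exists>z\<in>K. snd z = y - x" if "P x = P y" "x < y" "y - x \<le> t - s" for x y
  proof -
    obtain k where k: "0 < x + of_int k * L" "x + of_int k * L \<le> 0 + L"
      using period_representative[OF L] by metis
    have "y - x \<ge> L" using no_short[of x y] that by (cases "y < x + L") auto
    then have "(x + of_int k * L, y - x) \<in> K"
      using k that shift[of x k] shift[of y k]
      by (auto simp: K_def algebra_simps)
    then show ?thesis by force
  qed
  have "K \<noteq> {}" using representative[OF loop] by auto
  then obtain z where z: "z \<in> K" "\<And>z'. z' \<in> K \<Longrightarrow> snd z \<le> snd z'"
    using continuous_attains_inf[OF \<open>compact K\<close>, of snd] continuous_on_snd[OF continuous_on_id] by blast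
  define a b M where "a = fst z" and "b = fst z + snd z" and "M = snd z"
  have ab: "P a = P b" "b = a + M" and "M \<le> t - s"
    using z(1) by (auto simp: K_def a_def b_def M_def)
  have "M \<ge> L" "M \<noteq> L"
    using z(1) no_period[of a] ab by (auto simp: K_def M_def)
  then have M: "M > L" by simp
  have no_loop: "P x \<noteq> P y" if "x < y" "y < x + M" for x y
    using representative[of x y] z(2) that \<open>M \<le> t - s\<close> by (force simp: M_def)

  \<comment> \<open>The open strip of chords shorter than the shortest loop, hence nonzero.\<close>
  define S where "S = {(x, y). x < y \<and> y < x + M}"
  have "S = {z. inner (1, -1) z < 0} \<inter> {z. inner (-1, 1) z < M}"
    by (auto simp: S_def)
  then have "convex S" by (simp only: convex_Int convex_halfspace_lt)
  moreover have "continuous_on S (\<lambda>z. P (snd z) - P (fst z))"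
    by (intro continuous_intros continuous_on_compose2[OF cont]) auto
  moreover have "P (snd z) - P (fst z) \<noteq> 0" if "z \<in> S" for z
    using that no_loop by (force simp: S_def)
  moreover have "(a, a + L) \<in> S" using L M by (simp add: S_def)
  moreover have "P (snd (a, a + L)) - P (fst (a, a + L))
      = of_real (norm (P (snd (a, a + L)) - P (fst (a, a + L)))) * cis 0"
    using per c by simp
  ultimately have "\<exists>\<phi>. continuous_on S \<phi> \<and> \<phi> (a, a + L) = 0 \<and>
      (\<forall>z\<in>S. P (snd z) - P (fst z) = of_real (norm (P (snd z) - P (fst z))) * cis (\<phi> z))"
    by (rule angle_lift)
  then obtain \<phi> where \<phi>: "continuous_on S \<phi>" "\<phi> (a, a + L) = 0"
    and polar: "\<And>z. z \<in> S \<Longrightarrow> P (snd z) - P (fst z)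
        = of_real (norm (P (snd z) - P (fst z))) * cis (\<phi> z)"
    by blast
  have \<phi>_cont: "continuous_on T (\<lambda>x. \<phi> (g x))"
    if "continuous_on T g" "g ` T \<subseteq> S" for T and g :: "real \<Rightarrow> real \<times> real"
    by (rule continuous_on_compose2[OF \<phi>(1) that])

  have period: "\<phi> (x, x + L) = 0" for x
  proof -
    have "\<phi> (x, x + L) = \<phi> (a, a + L)"
    proof (rule cis_const_imp_const[of UNIV "\<lambda>x. \<phi> (x, x + L)" 1])
      show "continuous_on UNIV (\<lambda>x. \<phi> (x, x + L))"
        by (rule \<phi>_cont) (use L M in \<open>auto simp: S_def intro!: continuous_intros\<close>)
      show "cis (\<phi> (x, x + L)) = 1" for x
        using polar[of "(x, x + L)"] L M per c cis_of_polar_pos[of c] by (simp add: S_def)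
    qed auto
    then show ?thesis using \<phi>(2) by simp
  qed

  \<comment> \<open>The sign \<sigma> is 1 at a highest point and -1 at a lowest one. Chords leaving
    a highest point do not rise and chords reaching it do not fall. The period chord, of angle 0,
    bounds both half planes and so selects the branch.\<close>
  have extremal: "\<bar>\<phi> (t, y) - - (\<sigma> * pi / 2)\<bar> \<le> pi / 2 \<and> \<bar>\<phi> (x, t) - \<sigma> * pi / 2\<bar> \<le> pi / 2"
    if \<sigma>: "\<sigma> = 1 \<or> \<sigma> = -1" and max: "\<And>s. \<sigma> * Im (P s) \<le> \<sigma> * Im (P t)"
      and xy: "x < t" "t < x + M" "t < y" "y < t + M" for \<sigma> t x y
  proof
    have sin: "sin (\<phi> (x, y)) * norm (P y - P x) = Im (P y) - Im (P x)" if "(x, y) \<in> S" for x y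
      using arg_cong[OF polar[OF that], of Im] by (simp add: mult.commute)
    have cos: "cos (w + \<sigma> * pi / 2) = - (\<sigma> * sin w)" "cos (w - \<sigma> * pi / 2) = \<sigma> * sin w" for w
      using \<sigma> by (auto simp: cos_add cos_diff)
    show "\<bar>\<phi> (t, y) - - (\<sigma> * pi / 2)\<bar> \<le> pi / 2"
    proof (rule lift_stays_in_halfplane[of "{t<..<t + M}" "\<lambda>y. \<phi> (t, y)" _ "t + L"])
      fix y assume y: "y \<in> {t<..<t + M}"
      then have S: "(t, y) \<in> S" by (simp add: S_def)
      have "\<sigma> * sin (\<phi> (t, y)) * norm (P y - P t) \<le> 0"
        using max[of y] by (simp add: mult.assoc sin[OF S] right_diff_distrib)
      moreover have "norm (P y - P t) > 0" using no_loop[of t y] y by auto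
      ultimately have "\<sigma> * sin (\<phi> (t, y)) \<le> 0" by (simp add: mult_le_0_iff)
      then show "cos (\<phi> (t, y) - - (\<sigma> * pi / 2)) \<ge> 0" by (simp add: cos)
    next
      show "continuous_on {t<..<t + M} (\<lambda>y. \<phi> (t, y))"
        by (rule \<phi>_cont) (auto simp: S_def intro!: continuous_intros)
    qed (use \<sigma> xy L M period[of t] in auto)
    show "\<bar>\<phi> (x, t) - \<sigma> * pi / 2\<bar> \<le> pi / 2"
    proof (rule lift_stays_in_halfplane[of "{t - M<..<t}" "\<lambda>x. \<phi> (x, t)" _ "t - L"])
      fix x assume x: "x \<in> {t - M<..<t}"
      then have S: "(x, t) \<in> S" by (simp add: S_def)
      have "\<sigma> * sin (\<phi> (x, t)) * norm (P t - P x) \<ge> 0"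
        using max[of x] by (simp add: mult.assoc sin[OF S] right_diff_distrib)
      moreover have "norm (P t - P x) > 0" using no_loop[of x t] x by auto
      ultimately have "\<sigma> * sin (\<phi> (x, t)) \<ge> 0" by (simp add: zero_le_mult_iff)
      then show "cos (\<phi> (x, t) - \<sigma> * pi / 2) \<ge> 0" by (simp add: cos)
    next
      show "continuous_on {t - M<..<t} (\<lambda>x. \<phi> (x, t))"
        by (rule \<phi>_cont) (auto simp: S_def intro!: continuous_intros)
    qed (use \<sigma> xy L M period[of "t - L"] in auto)
  qed

  have Im_per: "Im (P (s + L)) = Im (P s)" for s using per by simp
  have Im_cont: "continuous_on UNIV (\<lambda>s. Im (P s))" by (intro continuous_intros cont)
  obtain t1 where t1: "a < t1" "t1 \<le> a + L" "\<And>s. Im (P s) \<le> Im (P t1)"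
    using periodic_attains_max[OF Im_cont L Im_per] by metis
  obtain t2 where t2: "a < t2" "t2 \<le> a + L" "\<And>s. - Im (P s) \<le> - Im (P t2)"
    using periodic_attains_max[of "\<lambda>s. - Im (P s)" L a] Im_cont L Im_per continuous_on_minus
    by metis
  define d where "d y = \<phi> (a, y) - \<phi> (y, b)" for y
  have opposite: "cis (d y) = -1" if "y \<in> {a<..<b}" for y
  proof -
    have "(a, y) \<in> S" "(y, b) \<in> S" using that ab by (auto simp: S_def)
    from polar[OF this(1)] polar[OF this(2)] no_loop[of a y] that show ?thesis
      unfolding d_def
      by (intro cis_of_polar_neg[of "P y - P a" "norm (P y - P a)"])
        (auto simp: ab norm_minus_commute)
  qed
  have "d t1 = d t2"
  proof (rule cis_const_imp_const[of "{a<..<b}" d])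
    show "continuous_on {a<..<b} d"
      unfolding d_def
      by (intro continuous_intros \<phi>_cont) (use ab in \<open>auto simp: S_def\<close>)
  qed (use opposite t1 t2 ab M in auto)
  \<comment> \<open>At the highest point the angle from \<open>a\<close> lies in [0, \<pi>] and the
    angle to \<open>b\<close> in [-\<pi>, 0].\<close>
  moreover have "d t1 \<ge> 0"
  proof -
    have "\<bar>\<phi> (t1, b) - - (1 * pi / 2)\<bar> \<le> pi / 2 \<and> \<bar>\<phi> (a, t1) - 1 * pi / 2\<bar> \<le> pi / 2"
      by (rule extremal) (use t1 ab M in auto)
    then show ?thesis unfolding d_def by linarith
  qed
  moreover have "d t2 \<le> 0"
  proof -
    have "\<bar>\<phi> (t2, b) - - (- 1 * pi / 2)\<bar> \<le> pi / 2 \<and> \<bar>\<phi> (a, t2) - - 1 * pi / 2\<bar> \<le> pi / 2"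
      by (rule extremal) (use t2 ab M in auto)
    then show ?thesis unfolding d_def by linarith
  qed
  ultimately have "d t1 = 0" by simp
  then show False using opposite[of t1] t1 ab M by (simp add: complex_eq_iff)
qed

subsection \<open>Curves parametrised by arc length\<close>

text \<open>The bisector of two directions that are not opposite serves as \<nu>.\<close>

lemma ex_common_halfplane:
  assumes "cis \<alpha> \<noteq> - cis \<beta>"
  obtains \<nu> where "\<bar>\<beta> - \<nu>\<bar> \<le> pi / 2" "cos (\<alpha> - \<nu>) > 0" "cos (\<beta> - \<nu>) > 0"
proof -
  define \<delta> where "\<delta> = \<alpha> - \<beta>"
  have \<delta>: "cos \<delta> \<noteq> -1"
  proof
    assume cos: "cos \<delta> = -1"
    then have "sin \<delta> = 0" using sin_cos_squared_add[of \<delta>] by simp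
    with cos have "cis \<delta> = -1" by (simp add: complex_eq_iff)
    then have "cis (\<delta> + \<beta>) = - cis \<beta>" by (simp flip: cis_mult)
    then show False using assms by (simp add: \<delta>_def)
  qed
  then have pos: "1 + cos \<delta> > 0" using cos_ge_minus_one[of \<delta>] by linarith
  \<comment> \<open>By the half-angle formula, w is half of the representative of \<delta> in
    (-\<pi>, \<pi>).\<close>
  define w where "w = arctan (sin \<delta> / (1 + cos \<delta>))"
  have w: "- (pi / 2) < w" "w < pi / 2" unfolding w_def by (rule arctan_lbound arctan_ubound)+
  then have cw: "cos w > 0" by (intro cos_gt_zero_pi)
  have "sin w = cos w * (sin \<delta> / (1 + cos \<delta>))"
    using cw tan_arctan[of "sin \<delta> / (1 + cos \<delta>)"] by (simp add: w_def tan_def field_simps)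
  then have "cos (\<delta> - w) = cos w * (cos \<delta> + (sin \<delta>)\<^sup>2 / (1 + cos \<delta>))"
    by (simp add: cos_diff algebra_simps power2_eq_square)
  also have "cos \<delta> + (sin \<delta>)\<^sup>2 / (1 + cos \<delta>) = 1"
    using pos by (simp add: sin_squared_eq field_simps power2_eq_square)
  finally have "cos (\<delta> - w) = cos w" by simp
  then show thesis
    using that[of "\<beta> + w"] w cw by (simp add: \<delta>_def algebra_simps)
qed

locale unit_speed_curve =
  fixes P :: "real \<Rightarrow> complex" and \<theta> :: "real \<Rightarrow> real"
  assumes deriv: "\<And>s. (P has_vector_derivative cis (\<theta> s)) (at s)"
    and \<theta>_cont: "continuous_on UNIV \<theta>"
begin

section \<open>Chord directions and tangent angles\<close>

lemma P_cont: "continuous_on UNIV P"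
  by (meson deriv has_vector_derivative_continuous continuous_at_imp_continuous_on)

text \<open>The difference quotient of \<open>P\<close>, written as a mean of tangents so that it is
  continuous across the diagonal.\<close>

definition secant :: "real \<times> real \<Rightarrow> complex" where
  "secant z = integral {0..1} (\<lambda>t. cis (\<theta> (fst z + t * (snd z - fst z))))"

lemma secant_diag: "secant (x, x) = cis (\<theta> x)"
  by (simp add: secant_def)

lemma secant_scaled: "of_real (y - x) * secant (x, y) = P y - P x"
proof -
  have "((\<lambda>t. of_real (y - x) * cis (\<theta> (x + t * (y - x)))) has_integral
      P (x + 1 * (y - x)) - P (x + 0 * (y - x))) {0..1}"
  proof (rule fundamental_theorem_of_calculus)
    fix t :: real
    have "((\<lambda>t. x + t * (y - x)) has_vector_derivative (y - x)) (at t)"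
      unfolding has_real_derivative_iff_has_vector_derivative[symmetric]
      by (auto intro!: derivative_eq_intros)
    from has_vector_derivative_at_within[OF vector_diff_chain_at[OF this deriv]]
    show "((\<lambda>t. P (x + t * (y - x))) has_vector_derivative
        of_real (y - x) * cis (\<theta> (x + t * (y - x)))) (at t within {0..1})"
      by (simp add: o_def scaleR_conv_of_real)
  qed simp
  from integral_unique[OF this] show ?thesis by (simp add: secant_def)
qed

lemma secant_cont: "continuous_on UNIV secant"
proof -
  have "continuous_on (UNIV \<times> cbox 0 1)
      (\<lambda>(z, t). cis (\<theta> (fst z + t * (snd z - fst z :: real))))"
    unfolding case_prod_beta
    by (intro continuous_intros continuous_on_compose2[OF \<theta>_cont]) auto
  from integral_continuous_on_param[OF this] show ?thesis
    by (simp add: secant_def[abs_def])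
qed

text \<open>The secant vanishes nowhere on \<open>S\<close>, and off the diagonal it is a positive
  multiple of the chord, so lifting its angle treats chords and tangents at once.\<close>

lemma tangent_angle_lift:
  assumes S: "convex S" "\<And>x y. (x, y) \<in> S \<Longrightarrow> x \<le> y" "(c, c) \<in> S"
    and inj: "\<And>x y. (x, y) \<in> S \<Longrightarrow> x < y \<Longrightarrow> P x \<noteq> P y"
  shows "\<exists>\<phi>. continuous_on S \<phi> \<and> (\<forall>x. (x, x) \<in> S \<longrightarrow> \<phi> (x, x) = \<theta> x) \<and>
    (\<forall>x y. (x, y) \<in> S \<longrightarrow> x < y \<longrightarrow> P y - P x = of_real (norm (P y - P x)) * cis (\<phi> (x, y)))"
proof -
  have nz: "secant z \<noteq> 0" if "z \<in> S" for z
  proof (cases z)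
    case (Pair x y)
    show ?thesis
    proof (cases "x = y")
      case False
      then show ?thesis
        using Pair that inj[of x y] S(2)[of x y] secant_scaled[of y x] by auto
    qed (simp add: Pair secant_diag)
  qed
  obtain \<phi> where \<phi>: "continuous_on S \<phi>" "\<phi> (c, c) = \<theta> c"
    and polar: "\<And>z. z \<in> S \<Longrightarrow> secant z = of_real (norm (secant z)) * cis (\<phi> z)"
    using angle_lift[OF S(1) continuous_on_subset[OF secant_cont] nz S(3), of "\<theta> c"]
    by (auto simp: secant_diag)
  show ?thesis
  proof (intro exI[of _ \<phi>] conjI allI impI \<phi>(1))
    fix x assume x: "(x, x) \<in> S"
    \<comment> \<open>The diagonal part of \<open>S\<close> is an interval, so agreement with
      \<theta> at \<open>c\<close> spreads along it.\<close>
    define T where "T = (\<lambda>x. (x, x)) -` S"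
    have "linear (\<lambda>x :: real. (x, x))" by (intro linearI) auto
    then have "convex T" unfolding T_def by (rule convex_linear_vimage[OF _ S(1)])
    then have "connected T" by (rule convex_connected)
    moreover have "continuous_on T (\<lambda>x. \<phi> (x, x) - \<theta> x)"
      by (intro continuous_intros continuous_on_compose2[OF \<phi>(1)] continuous_on_subset[OF \<theta>_cont])
        (auto simp: T_def)
    moreover have "cis (\<phi> (x, x) - \<theta> x) = 1" if "x \<in> T" for x
      by (rule cis_of_polar_eq[of "cis (\<theta> x)" 1])
        (use polar[of "(x, x)"] that in \<open>auto simp: secant_diag T_def\<close>)
    ultimately have "\<phi> (x, x) - \<theta> x = \<phi> (c, c) - \<theta> c"
      by (rule cis_const_imp_const) (use x S(3) in \<open>auto simp: T_def\<close>)
    then show "\<phi> (x, x) = \<theta> x" using \<phi>(2) by simp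
  next
    fix x y assume xy: "(x, y) \<in> S" "x < y"
    have "P y - P x = of_real (y - x) * (of_real (norm (secant (x, y))) * cis (\<phi> (x, y)))"
      using polar[OF xy(1)] by (metis secant_scaled)
    moreover have "norm (P y - P x) = (y - x) * norm (secant (x, y))"
      using xy(2) arg_cong[OF secant_scaled[of y x], of norm] by (simp only: norm_mult norm_of_real)
    ultimately show "P y - P x = of_real (norm (P y - P x)) * cis (\<phi> (x, y))"
      by simp
  qed
qed

section \<open>Arc length and height in a direction\<close>

lemma lipschitz:
  assumes "x \<le> y"
  shows "norm (P y - P x) \<le> y - x"
proof -
  have "norm (integral {x..y} (\<lambda>s. cis (\<theta> s))) \<le> integral {x..y} (\<lambda>_. 1 :: real)"
    by (rule integral_norm_bound_integral)
      (auto intro!: integrable_continuous_interval continuous_intros continuous_on_subset[OF \<theta>_cont])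
  moreover have "integral {x..y} (\<lambda>s. cis (\<theta> s)) = P y - P x"
    by (rule integral_unique, rule fundamental_theorem_of_calculus[OF assms])
      (rule has_vector_derivative_at_within[OF deriv])
  ultimately show ?thesis using assms by simp
qed

definition height :: "real \<Rightarrow> real \<Rightarrow> real" where
  "height \<nu> s = Re (cis (- \<nu>) * P s)"

lemma height_deriv: "(height \<nu> has_real_derivative cos (\<theta> s - \<nu>)) (at s)"
proof -
  have "((\<lambda>s. cis (- \<nu>) * P s) has_vector_derivative cis (- \<nu>) * cis (\<theta> s)) (at s)"
    by (intro derivative_intros deriv)
  then have "((\<lambda>s. Re (cis (- \<nu>) * P s)) has_vector_derivative Re (cis (- \<nu>) * cis (\<theta> s))) (at s)"
    by (rule bounded_linear.has_vector_derivative[OF bounded_linear_Re])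
  then show ?thesis
    by (simp add: height_def[abs_def] has_real_derivative_iff_has_vector_derivative cis_mult)
qed

lemma height_mono:
  assumes "x \<le> y" "\<And>s. x \<le> s \<Longrightarrow> s \<le> y \<Longrightarrow> cos (\<theta> s - \<nu>) \<ge> 0"
  shows "height \<nu> x \<le> height \<nu> y"
  by (rule DERIV_nonneg_imp_nondecreasing[OF assms(1)]) (use height_deriv assms(2) in blast)

text \<open>The gain in height along a chord is its length times cos(w - \<nu>).\<close>

lemma cos_nonneg_of_height:
  assumes "P y - P x = of_real (norm (P y - P x)) * cis w" "P x \<noteq> P y" "height \<nu> x \<le> height \<nu> y"
  shows "cos (w - \<nu>) \<ge> 0"
proof -
  have "height \<nu> y - height \<nu> x = Re (cis (- \<nu>) * (of_real (norm (P y - P x)) * cis w))"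
    unfolding height_def by (metis assms(1) minus_complex.sel(1) right_diff_distrib)
  also have "\<dots> = norm (P y - P x) * cos (w - \<nu>)"
    by (simp add: cos_diff algebra_simps)
  finally have "norm (P y - P x) * cos (w - \<nu>) \<ge> 0" using assms(3) by linarith
  moreover have "norm (P y - P x) > 0" using assms(2) by simp
  ultimately show ?thesis by (simp only: zero_le_mult_iff) linarith
qed


section \<open>Curvature of a loop\<close>

text \<open>Schur's comparison with the circle of length \<open>b - a\<close>, measured along the tangent at the midpoint.\<close>

lemma loop_curvature:
  assumes loop: "P a = P b" "a < b"
    and \<theta>': "\<And>s. (\<theta> has_real_derivative \<theta>' s) (at s)"
  obtains s where "\<bar>\<theta>' s\<bar> \<ge> 2 * pi / (b - a)"
proof (rule ccontr)
  assume "\<not> thesis"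
  then have bound: "\<bar>\<theta>' s\<bar> < 2 * pi / (b - a)" for s
    using that by (meson linorder_not_less)
  define m \<kappa> where "m = (a + b) / 2" and "\<kappa> = 2 * pi / (b - a)"
  have m: "a < m" "m < b" using loop(2) by (simp_all add: m_def field_simps)
  have \<kappa>: "\<kappa> > 0" "\<kappa> * (b - m) = pi" "\<kappa> * (m - a) = pi"
    using loop(2) by (simp_all add: \<kappa>_def m_def field_simps)
  \<comment> \<open>The subtracted term is the height on a circle of circumference b - a, tangent to
    the curve at \<open>m\<close>. It vanishes at both ends of the loop.\<close>
  define D where "D s = height (\<theta> m) s - sin (\<kappa> * (s - m)) / \<kappa>" for s
  have D': "(D has_real_derivative cos (\<theta> s - \<theta> m) - cos (\<kappa> * (s - m))) (at s)" for s
    unfolding D_def using \<kappa>(1) by (auto intro!: derivative_eq_intros height_deriv)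
  have close: "\<bar>\<theta> y - \<theta> x\<bar> < \<kappa> * (y - x)" if xy: "x < y" for x y
  proof -
    obtain z where z: "\<theta> y - \<theta> x = (y - x) * \<theta>' z"
      using MVT2[OF xy, of \<theta> \<theta>'] \<theta>' by auto
    show ?thesis
      using mult_strict_left_mono[OF bound[of z], of "y - x"] xy
      by (simp add: z \<kappa>_def abs_mult mult.commute)
  qed
  \<comment> \<open>From the midpoint the curve turns strictly less than the circle, which turns by
    at most \<pi>, and cosine decreases on [0, \<pi>].\<close>
  have pos: "cos (\<theta> s - \<theta> m) - cos (\<kappa> * (s - m)) > 0" if s: "s \<noteq> m" "a \<le> s" "s \<le> b" for s
  proof -
    have "\<bar>\<theta> s - \<theta> m\<bar> < \<kappa> * \<bar>s - m\<bar>"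
      using close[of s m] close[of m s] s(1) by (cases "s < m") auto
    moreover have "\<bar>s - m\<bar> \<le> b - m" using s m_def by (simp add: abs_le_iff field_simps)
    then have "\<kappa> * \<bar>s - m\<bar> \<le> \<kappa> * (b - m)" using \<kappa>(1) by simp
    then have "\<kappa> * \<bar>s - m\<bar> \<le> pi" using \<kappa>(2) by simp
    ultimately have "cos (\<kappa> * \<bar>s - m\<bar>) < cos \<bar>\<theta> s - \<theta> m\<bar>"
      by (intro cos_monotone_0_pi) auto
    moreover have "\<kappa> * \<bar>s - m\<bar> = \<bar>\<kappa> * (s - m)\<bar>" using \<kappa>(1) by (simp add: abs_mult)
    ultimately show ?thesis by (simp only: cos_abs_real)
  qed
  have cont: "continuous_on S D" for S
    by (rule DERIV_continuous_on[OF has_field_derivative_at_within[OF D']])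
  have "D a < D m"
    by (rule DERIV_pos_imp_increasing_open[OF m(1) _ cont]) (use D' pos m in force)
  also have "D m < D b"
    by (rule DERIV_pos_imp_increasing_open[OF m(2) _ cont]) (use D' pos m in force)
  finally have "D a < D b" .
  moreover have "\<kappa> * (a - m) = - pi" using \<kappa>(3) by (simp add: algebra_simps)
  then have "D a = D b"
    unfolding D_def using \<kappa>(2) by (simp add: height_def loop(1))
  ultimately show False by simp
qed

section \<open>A second loop\<close>

text \<open>If the loop \<open>(a, b)\<close> were the only one in the regions \<open>W\<close>, \<open>E\<close>, \<open>R\<close> below, the direction of
  \<open>P y - P x\<close> would lift to each of them. Take a half plane, with inner normal angle \<open>\<nu>\<close>, that
  contains both tangents at the corner. Cutting off the loop leaves a periodic curve with
  a corner (chords in \<open>E\<close> and \<open>R\<close>), whose rotation number is zero: \<open>\<theta> a\<close> and \<open>\<theta> b\<close> lie in the same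
  lift of the half plane. The loop itself (chords in \<open>W\<close>) is a simple closed curve with rotation
  number \<open>1\<close> or \<open>-1\<close>, by Hopf's argument: \<open>\<theta> a\<close> and \<open>\<theta> b\<close> lie in different lifts.\<close>

lemma ex_second_loop:
  assumes L: "L > 0" and per: "\<And>s. P (s + L) = P s + of_real c" and c: "c > 0"
    and \<theta>_per: "\<And>s. \<theta> (s + L) = \<theta> s"
    and loop: "P a = P b" "a < b" "b < a + L" and corner: "cis (\<theta> a) \<noteq> - cis (\<theta> b)"
  obtains x y where "x < y" "P x = P y" "(x, y) \<noteq> (a, b)"
    "a \<le> x \<and> y \<le> b \<or> b \<le> x \<and> y \<le> a + L \<or> x \<le> a \<and> b \<le> y \<and> y \<le> x + L"
proof (rule ccontr)
  note found = that
  assume contra: "\<not> thesis"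
  have simple: "P x \<noteq> P y" if "x < y" "(x, y) \<noteq> (a, b)"
    "a \<le> x \<and> y \<le> b \<or> b \<le> x \<and> y \<le> a + L \<or> x \<le> a \<and> b \<le> y \<and> y \<le> x + L" for x y
    using found[of x y] contra that by blast

  \<comment> \<open>\<open>W\<close> collects chords within the loop, \<open>E\<close> those of the
    complementary arc, and \<open>R\<close> those spanning the loop and at most a period long. The
    strict inequalities remove the loop (a, b) itself, a corner of \<open>W\<close> and
    \<open>R\<close>, which keeps both convex.\<close>
  define W where "W = {(x, y). a \<le> x \<and> x \<le> y \<and> y \<le> b \<and> y - x < b - a}"
  define E where "E = {(x, y). b \<le> x \<and> x \<le> y \<and> y \<le> a + L}"
  define R where "R = {(x, y). x \<le> a \<and> b \<le> y \<and> y - x \<le> L \<and> b - a < y - x}"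
  have "W = {z. inner (-1, 0) z \<le> - a} \<inter> {z. inner (1, -1) z \<le> 0} \<inter> {z. inner (0, 1) z \<le> b}
      \<inter> {z. inner (-1, 1) z < b - a}"
    by (auto simp: W_def)
  then have W_convex: "convex W"
    by (simp only:) (intro convex_Int convex_halfspace_le convex_halfspace_lt)
  have "E = {z. inner (-1, 0) z \<le> - b} \<inter> {z. inner (1, -1) z \<le> 0} \<inter> {z. inner (0, 1) z \<le> a + L}"
    by (auto simp: E_def)
  then have E_convex: "convex E"
    by (simp only:) (intro convex_Int convex_halfspace_le)
  have "R = {z. inner (1, 0) z \<le> a} \<inter> {z. inner (0, -1) z \<le> - b} \<inter> {z. inner (-1, 1) z \<le> L}
      \<inter> {z. inner (1, -1) z < a - b}"
    by (auto simp: R_def)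
  then have R_convex: "convex R"
    by (simp only:) (intro convex_Int convex_halfspace_le convex_halfspace_lt)

  have W_le: "x \<le> y" if "(x, y) \<in> W" for x y using that by (simp add: W_def)
  have E_le: "x \<le> y" if "(x, y) \<in> E" for x y using that by (simp add: E_def)
  have W_a: "(a, a) \<in> W" using loop(2) by (simp add: W_def)
  have E_b: "(b, b) \<in> E" using loop(3) by (simp add: E_def)
  have simple_W: "P x \<noteq> P y" if "(x, y) \<in> W" "x < y" for x y
    by (rule simple) (use that in \<open>auto simp: W_def\<close>)
  have simple_E: "P x \<noteq> P y" if "(x, y) \<in> E" "x < y" for x y
    by (rule simple) (use that loop(2) in \<open>auto simp: E_def\<close>)
  have simple_R: "P x \<noteq> P y" if "(x, y) \<in> R" for x y
    by (rule simple) (use that loop(2) in \<open>auto simp: R_def\<close>)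
  obtain \<phi>W where \<phi>W: "continuous_on W \<phi>W" "\<And>x. (x, x) \<in> W \<Longrightarrow> \<phi>W (x, x) = \<theta> x"
    "\<And>x y. (x, y) \<in> W \<Longrightarrow> x < y \<Longrightarrow> P y - P x = of_real (norm (P y - P x)) * cis (\<phi>W (x, y))"
    using tangent_angle_lift[OF W_convex W_le _ simple_W, of a] W_a by blast
  obtain \<phi>E where \<phi>E: "continuous_on E \<phi>E" "\<And>x. (x, x) \<in> E \<Longrightarrow> \<phi>E (x, x) = \<theta> x"
    "\<And>x y. (x, y) \<in> E \<Longrightarrow> x < y \<Longrightarrow> P y - P x = of_real (norm (P y - P x)) * cis (\<phi>E (x, y))"
    using tangent_angle_lift[OF E_convex E_le _ simple_E, of b] E_b by blast
  have base: "P (a + L) - P a = of_real (norm (P (a + L) - P a)) * cis (\<phi>E (b, a + L))"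
    using \<phi>E(3)[of b "a + L"] loop by (auto simp: E_def)
  have R_cont: "continuous_on R (\<lambda>z. P (snd z) - P (fst z))"
    by (intro continuous_intros continuous_on_compose2[OF P_cont]) auto
  have R_nz: "P (snd z) - P (fst z) \<noteq> 0" if "z \<in> R" for z
    using simple_R[of "fst z" "snd z"] that by simp
  have R_a: "(a, a + L) \<in> R" using loop(3) by (simp add: R_def)
  have "\<exists>\<phi>. continuous_on R \<phi> \<and> \<phi> (a, a + L) = \<phi>E (b, a + L) \<and>
      (\<forall>z\<in>R. P (snd z) - P (fst z) = of_real (norm (P (snd z) - P (fst z))) * cis (\<phi> z))"
    by (rule angle_lift[OF R_convex R_cont R_nz R_a]) (use base in simp_all)
  then obtain \<phi>R where \<phi>R: "continuous_on R \<phi>R" "\<phi>R (a, a + L) = \<phi>E (b, a + L)"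
    and polar_R: "\<forall>z\<in>R. P (snd z) - P (fst z) = of_real (norm (P (snd z) - P (fst z))) * cis (\<phi>R z)"
    by blast
  have \<phi>R_polar: "P y - P x = of_real (norm (P y - P x)) * cis (\<phi>R (x, y))" if "(x, y) \<in> R" for x y
    using bspec[OF polar_R that] by simp
  note cont_on = continuous_on_compose2[OF \<phi>W(1)] continuous_on_compose2[OF \<phi>E(1)]
    continuous_on_compose2[OF \<phi>R(1)]

  \<comment> \<open>Since \<open>P a = P b\<close>, chords from \<open>a\<close> and from
    \<open>b\<close> coincide; the branches agree at a + L by normalisation.\<close>
  have \<phi>R_right: "\<phi>R (a, y) = \<phi>E (b, y)" if y: "b < y" "y \<le> a + L" for y
  proof -
    have "\<phi>R (a, y) - \<phi>E (b, y) = \<phi>R (a, a + L) - \<phi>E (b, a + L)"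
    proof (rule cis_const_imp_const[of "{b<..a + L}" "\<lambda>y. \<phi>R (a, y) - \<phi>E (b, y)"])
      show "continuous_on {b<..a + L} (\<lambda>y. \<phi>R (a, y) - \<phi>E (b, y))"
        by (intro continuous_intros cont_on) (use loop in \<open>auto simp: R_def E_def\<close>)
      fix y assume y: "y \<in> {b<..a + L}"
      then show "cis (\<phi>R (a, y) - \<phi>E (b, y)) = 1"
        using \<phi>R_polar[of a y] \<phi>E(3)[of b y] simple_R[of a y] loop
        by (intro cis_of_polar_eq[of "P y - P a" "norm (P y - P a)"]) (auto simp: R_def E_def)
    qed (use y loop in auto)
    then show ?thesis using \<phi>R(2) by simp
  qed
  \<comment> \<open>Period chords all equal the positive number \<open>c\<close>.\<close>
  have \<phi>R_period: "\<phi>R (x, x + L) = \<phi>E (b, a + L)" if x: "b - L \<le> x" "x \<le> a" for x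
  proof -
    have "\<phi>R (x, x + L) = \<phi>R (a, a + L)"
    proof (rule cis_const_imp_const[of "{b - L..a}" "\<lambda>x. \<phi>R (x, x + L)"])
      show "continuous_on {b - L..a} (\<lambda>x. \<phi>R (x, x + L))"
        by (intro continuous_intros cont_on) (use loop in \<open>auto simp: R_def\<close>)
      fix x assume x: "x \<in> {b - L..a}"
      then show "cis (\<phi>R (x, x + L)) = 1"
        using \<phi>R_polar[of x "x + L"] loop per c by (intro cis_of_polar_pos[of c]) (auto simp: R_def)
    qed (use x loop in auto)
    then show ?thesis using \<phi>R(2) by simp
  qed
  \<comment> \<open>The chord from x to b is that from x to a, translated by one period.\<close>
  have \<phi>R_left: "\<phi>R (x, b) = \<phi>E (x + L, a + L)" if x: "b - L \<le> x" "x < a" for x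
  proof -
    have "\<phi>R (x, b) - \<phi>E (x + L, a + L) = \<phi>R (b - L, b) - \<phi>E (b - L + L, a + L)"
    proof (rule cis_const_imp_const[of "{b - L..<a}" "\<lambda>x. \<phi>R (x, b) - \<phi>E (x + L, a + L)"])
      show "continuous_on {b - L..<a} (\<lambda>x. \<phi>R (x, b) - \<phi>E (x + L, a + L))"
        by (intro continuous_intros cont_on) (use loop in \<open>auto simp: R_def E_def\<close>)
      fix x assume x: "x \<in> {b - L..<a}"
      then show "cis (\<phi>R (x, b) - \<phi>E (x + L, a + L)) = 1"
        using \<phi>R_polar[of x b] \<phi>E(3)[of "x + L" "a + L"] simple_R[of x b] loop per
        by (intro cis_of_polar_eq[of "P b - P x" "norm (P b - P x)"]) (auto simp: R_def E_def)
    qed (use x loop in auto)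
    then show ?thesis using \<phi>R_period[of "b - L"] loop by simp
  qed

  \<comment> \<open>Only the branch of \<theta> b is fixed here; the branch of \<theta> a comes from
    the rotation number of the remaining curve.\<close>
  obtain \<nu> where \<nu>: "\<bar>\<theta> b - \<nu>\<bar> \<le> pi / 2" "cos (\<theta> a - \<nu>) > 0" "cos (\<theta> b - \<nu>) > 0"
    using ex_common_halfplane[OF corner] by metis
  have near: "\<exists>e>0. \<forall>s. \<bar>s - d\<bar> \<le> e \<longrightarrow> cos (\<theta> s - \<nu>) \<ge> 0" if "cos (\<theta> d - \<nu>) > 0" for d
  proof -
    have "isCont (\<lambda>s. cos (\<theta> s - \<nu>)) d"
      using \<theta>_cont by (intro continuous_intros) (simp add: continuous_on_eq_continuous_at)
    then have "((\<lambda>s. cos (\<theta> s - \<nu>)) \<longlongrightarrow> cos (\<theta> d - \<nu>)) (nhds d)"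
      using tendsto_at_iff_tendsto_nhds[of "\<lambda>s. cos (\<theta> s - \<nu>)" d] by (simp add: isCont_def)
    from order_tendstoD(1)[OF this that] obtain e
      where e: "e > 0" "\<And>s. dist s d < e \<Longrightarrow> cos (\<theta> s - \<nu>) > 0"
      by (auto simp: eventually_nhds_metric)
    have "cos (\<theta> s - \<nu>) \<ge> 0" if "\<bar>s - d\<bar> \<le> e / 2" for s
      using e(2)[of s] that e(1) by (simp add: dist_real_def)
    then show ?thesis using e(1) by (intro exI[of _ "e / 2"]) simp
  qed
  obtain ea where ea: "ea > 0" "\<And>s. \<bar>s - a\<bar> \<le> ea \<Longrightarrow> cos (\<theta> s - \<nu>) \<ge> 0"
    using near[OF \<nu>(2)] by blast
  obtain eb where eb: "eb > 0" "\<And>s. \<bar>s - b\<bar> \<le> eb \<Longrightarrow> cos (\<theta> s - \<nu>) \<ge> 0"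
    using near[OF \<nu>(3)] by blast
  \<comment> \<open>\<open>ea\<close> and \<open>eb\<close> keep the height monotone near the
    corner, halving b - a makes \<epsilon> < b - a strict, and the last term keeps b + \<epsilon>
    within a + L.\<close>
  define \<epsilon> where "\<epsilon> = min (min ea eb) (min ((b - a) / 2) (L - (b - a)))"
  have \<epsilon>: "\<epsilon> > 0" "\<epsilon> \<le> ea" "\<epsilon> \<le> eb" "\<epsilon> < b - a" "\<epsilon> \<le> L - (b - a)"
    using ea(1) eb(1) loop(2,3) by (auto simp: \<epsilon>_def min_less_iff_disj)
  have mono_a: "height \<nu> x \<le> height \<nu> y" if "x \<le> y" "a - \<epsilon> \<le> x" "y \<le> a + \<epsilon>" for x y
    by (rule height_mono[OF that(1) ea(2)]) (use that \<epsilon> in auto)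
  have mono_b: "height \<nu> x \<le> height \<nu> y" if "x \<le> y" "b - \<epsilon> \<le> x" "y \<le> b + \<epsilon>" for x y
    by (rule height_mono[OF that(1) eb(2)]) (use that \<epsilon> in auto)
  have mono_aL: "height \<nu> x \<le> height \<nu> y" if "x \<le> y" "a + L - \<epsilon> \<le> x" "y \<le> a + L" for x y
  proof (rule height_mono[OF that(1)])
    fix s assume "x \<le> s" "s \<le> y"
    then show "cos (\<theta> s - \<nu>) \<ge> 0" using ea(2)[of "s - L"] \<theta>_per[of "s - L"] that \<epsilon> by auto
  qed
  have same: "height \<nu> a = height \<nu> b" by (simp add: height_def loop(1))

  \<comment> \<open>The branch is carried from the tangent at b to the one at a: through
    \<open>E\<close> to (b, b + \<epsilon>), in \<open>R\<close> from (a, b + \<epsilon>) to (a -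
    \<epsilon>, b), then in \<open>E\<close> from (a + L - \<epsilon>, a + L) to the diagonal. No
    chord on the way loses height.\<close>
  have "\<bar>\<phi>E (b, b + \<epsilon>) - \<nu>\<bar> \<le> pi / 2"
  proof (rule lift_stays_in_halfplane[of "{b..b + \<epsilon>}" "\<lambda>y. \<phi>E (b, y)" _ b])
    show "continuous_on {b..b + \<epsilon>} (\<lambda>y. \<phi>E (b, y))"
      by (intro continuous_intros cont_on) (use loop \<epsilon> in \<open>auto simp: E_def\<close>)
    fix y assume y: "y \<in> {b..b + \<epsilon>}"
    then have E: "(b, y) \<in> E" using \<epsilon> by (auto simp: E_def)
    show "cos (\<phi>E (b, y) - \<nu>) \<ge> 0"
    proof (cases "y = b")
      case False
      then show ?thesis using y \<epsilon> E \<phi>E(3)[OF E] simple[of b y]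
        by (intro cos_nonneg_of_height[of y b] mono_b) auto
    qed (use \<phi>E(2)[of b] \<nu> E in \<open>auto simp: E_def\<close>)
  qed (use \<phi>E(2)[of b] \<nu> \<epsilon> loop in \<open>auto simp: E_def\<close>)
  then have north: "\<bar>\<phi>R (a, b + \<epsilon>) - \<nu>\<bar> \<le> pi / 2"
    using \<phi>R_right[of "b + \<epsilon>"] \<epsilon> by simp
  have "\<bar>\<phi>R (a - 1 * \<epsilon>, b + (1 - 1) * \<epsilon>) - \<nu>\<bar> \<le> pi / 2"
  proof (rule lift_stays_in_halfplane[of "{0..1}" "\<lambda>t. \<phi>R (a - t * \<epsilon>, b + (1 - t) * \<epsilon>)" _ 0])
    have R: "(a - t * \<epsilon>, b + (1 - t) * \<epsilon>) \<in> R" if "t \<in> {0..1}" for t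
      using that \<epsilon> mult_nonneg_nonneg[of t \<epsilon>] mult_nonneg_nonneg[of "1 - t" \<epsilon>]
      by (auto simp: R_def algebra_simps)
    then show "continuous_on {0..1} (\<lambda>t. \<phi>R (a - t * \<epsilon>, b + (1 - t) * \<epsilon>))"
      by (intro continuous_intros cont_on) auto
    fix t :: real assume t: "t \<in> {0..1}"
    have "0 \<le> t * \<epsilon>" "t * \<epsilon> \<le> \<epsilon>" "0 \<le> (1 - t) * \<epsilon>" "(1 - t) * \<epsilon> \<le> \<epsilon>"
      using t \<epsilon>(1) by (auto simp: mult_le_cancel_right1)
    then have "height \<nu> (a - t * \<epsilon>) \<le> height \<nu> (b + (1 - t) * \<epsilon>)"
      using mono_a[of "a - t * \<epsilon>" a] mono_b[of b "b + (1 - t) * \<epsilon>"] same \<epsilon>(1) by linarith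
    then show "cos (\<phi>R (a - t * \<epsilon>, b + (1 - t) * \<epsilon>) - \<nu>) \<ge> 0"
      by (rule cos_nonneg_of_height[OF \<phi>R_polar[OF R[OF t]] simple_R[OF R[OF t]]])
  qed (use north in auto)
  then have west: "\<bar>\<phi>E (a + L - \<epsilon>, a + L) - \<nu>\<bar> \<le> pi / 2"
    using \<phi>R_left[of "a - \<epsilon>"] \<epsilon> by (simp add: algebra_simps)
  have "\<bar>\<phi>E (a + L, a + L) - \<nu>\<bar> \<le> pi / 2"
  proof (rule lift_stays_in_halfplane[of "{a + L - \<epsilon>..a + L}" "\<lambda>x. \<phi>E (x, a + L)" _ "a + L - \<epsilon>"])
    show "continuous_on {a + L - \<epsilon>..a + L} (\<lambda>x. \<phi>E (x, a + L))"
      by (intro continuous_intros cont_on) (use loop \<epsilon> in \<open>auto simp: E_def\<close>)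
    fix x assume x: "x \<in> {a + L - \<epsilon>..a + L}"
    then have E: "(x, a + L) \<in> E" using \<epsilon> by (auto simp: E_def)
    show "cos (\<phi>E (x, a + L) - \<nu>) \<ge> 0"
    proof (cases "x = a + L")
      case False
      then show ?thesis using x \<epsilon> E \<phi>E(3)[OF E] simple[of x "a + L"]
        by (intro cos_nonneg_of_height[of "a + L" x] mono_aL) auto
    qed (use \<phi>E(2)[of "a + L"] \<nu> E \<theta>_per[of a] in \<open>auto simp: E_def\<close>)
  qed (use west \<epsilon> in auto)
  then have \<theta>a: "\<bar>\<theta> a - \<nu>\<bar> \<le> pi / 2"
    using \<phi>E(2)[of "a + L"] loop \<theta>_per[of a] by (auto simp: E_def)

  \<comment> \<open>Chords from a to y and from y to b are opposite, so \<delta> is an odd multiple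
    of \<pi>, the turning of the loop seen by Hopf's argument.\<close>
  define \<delta> where "\<delta> = \<phi>W (a, a + \<epsilon>) - \<phi>W (a + \<epsilon>, b)"
  have opposite: "cis (\<phi>W (a, y) - \<phi>W (y, b)) = -1" if y: "y \<in> {a<..<b}" for y
  proof (rule cis_of_polar_neg)
    have W: "(a, y) \<in> W" "(y, b) \<in> W" using y by (auto simp: W_def)
    show "P y - P a = of_real (norm (P y - P a)) * cis (\<phi>W (a, y))"
      using \<phi>W(3)[OF W(1)] y by simp
    have "P b - P y = of_real (norm (P b - P y)) * cis (\<phi>W (y, b))"
      using \<phi>W(3)[OF W(2)] y by simp
    then show "- (P y - P a) = of_real (norm (P y - P a)) * cis (\<phi>W (y, b))"
      by (metis loop(1) minus_diff_eq norm_minus_commute)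
    show "P y - P a \<noteq> 0" using simple_W[OF W(1)] y by simp
  qed
  have \<delta>: "\<phi>W (a, y) - \<phi>W (y, b) = \<delta>" if "y \<in> {a<..<b}" for y
    unfolding \<delta>_def
  proof (rule cis_const_imp_const[of "{a<..<b}" "\<lambda>y. \<phi>W (a, y) - \<phi>W (y, b)"])
    show "continuous_on {a<..<b} (\<lambda>y. \<phi>W (a, y) - \<phi>W (y, b))"
      by (intro continuous_intros cont_on) (auto simp: W_def)
  qed (use opposite that \<epsilon> in auto)
  have cis\<delta>: "cis \<delta> = -1" using opposite[of "a + \<epsilon>"] \<epsilon> unfolding \<delta>_def by simp
  have cos_\<delta>: "cos (w - (\<nu> + \<delta>)) = - cos (w - \<nu>)" for w
  proof -
    have "cis (w - \<nu> - \<delta>) = - cis (w - \<nu>)" using cis\<delta> by (simp flip: cis_divide)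
    then show ?thesis by (simp add: complex_eq_iff diff_diff_eq)
  qed

  have "\<bar>\<phi>W (b - \<epsilon>, b) - \<nu>\<bar> \<le> pi / 2"
  proof (rule lift_stays_in_halfplane[of "{b - \<epsilon>..b}" "\<lambda>x. \<phi>W (x, b)" _ b])
    show "continuous_on {b - \<epsilon>..b} (\<lambda>x. \<phi>W (x, b))"
      by (intro continuous_intros cont_on) (use loop \<epsilon> in \<open>auto simp: W_def\<close>)
    fix x assume x: "x \<in> {b - \<epsilon>..b}"
    then have W: "(x, b) \<in> W" using \<epsilon> by (auto simp: W_def)
    show "cos (\<phi>W (x, b) - \<nu>) \<ge> 0"
    proof (cases "x = b")
      case False
      then show ?thesis using x \<epsilon> W \<phi>W(3)[OF W] simple[of x b]
        by (intro cos_nonneg_of_height[of b x] mono_b) auto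
    qed (use \<phi>W(2)[of b] \<nu> W in auto)
  qed (use \<phi>W(2)[of b] \<nu> \<epsilon> loop in \<open>auto simp: W_def\<close>)
  then have south: "\<bar>\<phi>W (a, b - \<epsilon>) - (\<nu> + \<delta>)\<bar> \<le> pi / 2"
    using \<delta>[of "b - \<epsilon>"] \<epsilon> by (simp add: algebra_simps)
  \<comment> \<open>Past the removed corner from inside, the starting point is at least as high as
    the end point, so it is the reversed chord, of angle \<phi>W - \<delta>, that does not lose
    height.\<close>
  have "\<bar>\<phi>W (a + 1 * \<epsilon>, b - (1 - 1) * \<epsilon>) - (\<nu> + \<delta>)\<bar> \<le> pi / 2"
  proof (rule lift_stays_in_halfplane[of "{0..1}" "\<lambda>t. \<phi>W (a + t * \<epsilon>, b - (1 - t) * \<epsilon>)" _ 0])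
    have W: "(a + t * \<epsilon>, b - (1 - t) * \<epsilon>) \<in> W" if "t \<in> {0..1}" for t
      using that \<epsilon> mult_nonneg_nonneg[of t \<epsilon>] mult_nonneg_nonneg[of "1 - t" \<epsilon>]
      by (auto simp: W_def algebra_simps)
    then show "continuous_on {0..1} (\<lambda>t. \<phi>W (a + t * \<epsilon>, b - (1 - t) * \<epsilon>))"
      by (intro continuous_intros cont_on) auto
    fix t :: real assume t: "t \<in> {0..1}"
    let ?x = "a + t * \<epsilon>" and ?y = "b - (1 - t) * \<epsilon>"
    have te: "0 \<le> t * \<epsilon>" "t * \<epsilon> \<le> \<epsilon>" "0 \<le> (1 - t) * \<epsilon>" "(1 - t) * \<epsilon> \<le> \<epsilon>"
      using t \<epsilon>(1) by (auto simp: mult_le_cancel_right1)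
    then have height: "height \<nu> ?y \<le> height \<nu> ?x"
      using mono_a[of a ?x] mono_b[of ?y b] same \<epsilon>(1) by linarith
    have "?x < ?y" using \<epsilon> by (simp add: algebra_simps)
    have "P ?x \<noteq> P ?y" using simple[of ?x ?y] te \<open>?x < ?y\<close> \<epsilon> by (auto simp: algebra_simps)
    moreover have "P ?x - P ?y = of_real (norm (P ?x - P ?y)) * cis (\<phi>W (?x, ?y) - \<delta>)"
      using \<phi>W(3)[OF W[OF t] \<open>?x < ?y\<close>] cis\<delta>
      by (simp add: norm_minus_commute flip: cis_divide) (metis minus_diff_eq)
    ultimately have "cos (\<phi>W (?x, ?y) - \<delta> - \<nu>) \<ge> 0"
      using height by (intro cos_nonneg_of_height[of ?x ?y]) auto
    then show "cos (\<phi>W (?x, ?y) - (\<nu> + \<delta>)) \<ge> 0"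
      by (simp add: algebra_simps)
  qed (use south in auto)
  then have "\<bar>\<phi>W (a + \<epsilon>, b) - (\<nu> + \<delta>)\<bar> \<le> pi / 2" by simp
  moreover have "\<bar>\<phi>W (a, a + \<epsilon>) - \<nu>\<bar> \<le> pi / 2"
  proof (rule lift_stays_in_halfplane[of "{a..a + \<epsilon>}" "\<lambda>y. \<phi>W (a, y)" _ a])
    show "continuous_on {a..a + \<epsilon>} (\<lambda>y. \<phi>W (a, y))"
      by (intro continuous_intros cont_on) (use loop \<epsilon> in \<open>auto simp: W_def\<close>)
    fix y assume y: "y \<in> {a..a + \<epsilon>}"
    then have W: "(a, y) \<in> W" using \<epsilon> by (auto simp: W_def)
    show "cos (\<phi>W (a, y) - \<nu>) \<ge> 0"
    proof (cases "y = a")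
      case False
      then show ?thesis using y \<epsilon> W \<phi>W(3)[OF W] simple[of a y]
        by (intro cos_nonneg_of_height[of y a] mono_a) auto
    qed (use \<phi>W(2)[of a] \<nu> W in auto)
  qed (use \<phi>W(2)[of a] \<theta>a \<epsilon> loop in \<open>auto simp: W_def\<close>)
  \<comment> \<open>\<delta> is the difference of an angle within \<pi>/2 of \<nu> and one within
    \<pi>/2 of \<nu> + \<delta>, so 2\<delta> is at most \<pi> in absolute value.\<close>
  ultimately have "\<bar>\<delta>\<bar> \<le> pi / 2"
    using \<delta>_def by (simp only: abs_le_iff) linarith
  then have "cos \<delta> \<ge> 0" by (intro cos_ge_zero) auto
  then show False using cis\<delta> by (simp add: complex_eq_iff)
qed

section \<open>From one period to the excess length\<close>

lemma ex_short_loop: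
  assumes per: "\<And>s. P (s + L) = P s + of_real c" and "L > 0" "c > 0"
    and loop: "P s = P t" "s \<noteq> t"
  obtains x y where "x < y" "y \<le> x + (L - c)" "P x = P y"
proof -
  obtain s' t' where st: "P s' = P t'" "s' < t'"
    using loop by (metis linorder_neqE)
  obtain x y where xy: "x < y" "y < x + L" "P x = P y"
    using ex_loop_shorter_than_period[of P L c s' t', OF P_cont assms(2,3) per st] by blast
  \<comment> \<open>The arc from y to x + L joins points at distance c, so it has length at least
    c.\<close>
  have "norm (P (x + L) - P y) \<le> x + L - y" using xy(2) by (intro lipschitz) simp
  then have "y \<le> x + (L - c)" using per[of x] xy(3) \<open>c > 0\<close> by simp
  then show thesis using that xy by blast
qed

end

subsection \<open>Periodic curves with simple crossings\<close>

theorem mainTheorem1: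
  fixes L :: real
    and u v \<theta> :: "real \<Rightarrow> real"
    and p :: "real \<Rightarrow> real \<times> real"
  assumes "L > 0"
    and "p = (\<lambda>s. (u s, v s))"
    and "smooth p"
    and "\<And>s. u (s + L) = 2 * pi + u s"
    and "\<And>s. v (s + L) = v s"
    and "\<And>s. (deriv u s)\<^sup>2 + (deriv v s)\<^sup>2 = 1"
    and "smooth \<theta>"
    and "\<And>s. vector_derivative p (at s) = (cos (\<theta> s), sin (\<theta> s))"
    and "\<And>q. crossing p q \<Longrightarrow> simple_crossing p q"
  shows "((\<forall>a. inj_on p {a..a + (L - 2 * pi)}) \<longrightarrow> inj p) \<and>
         (\<not> inj p \<longrightarrow> (\<exists>s. \<bar>deriv \<theta> s\<bar> \<ge> 2 * pi / (L - 2 * pi))) \<and>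
         (\<not> inj p \<and> (\<forall>s. \<theta> (s + L) = \<theta> s) \<longrightarrow>
            (\<exists>a q1 q2. q1 \<noteq> q2 \<and>
               (\<exists>s1\<in>{a..a + L}. \<exists>t1\<in>{a..a + L}. s1 \<noteq> t1 \<and> p s1 = q1 \<and> p t1 = q1) \<and>
               (\<exists>s2\<in>{a..a + L}. \<exists>t2\<in>{a..a + L}. s2 \<noteq> t2 \<and> p s2 = q2 \<and> p t2 = q2)))"
proof -
  define P where "P s = Complex (u s) (v s)" for s
  have p_eq: "p s = p t \<longleftrightarrow> P s = P t" for s t
    by (simp add: assms(2) P_def)
  have P_deriv: "(P has_vector_derivative cis (\<theta> s)) (at s)" for s
  proof -
    have "p differentiable (at s)"
      using assms(3) unfolding smooth_def by (metis funpow_0)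
    then have "(p has_vector_derivative (cos (\<theta> s), sin (\<theta> s))) (at s)"
      using assms(8) vector_derivative_works by metis
    moreover have "bounded_linear (\<lambda>z. of_real (fst z) + \<i> * of_real (snd z))"
      by (intro bounded_linear_add bounded_linear_const_mult
          bounded_linear_compose[OF bounded_linear_of_real] bounded_linear_fst bounded_linear_snd)
    ultimately have "((\<lambda>s. of_real (fst (p s)) + \<i> * of_real (snd (p s))) has_vector_derivative
        of_real (cos (\<theta> s)) + \<i> * of_real (sin (\<theta> s))) (at s)"
      using bounded_linear.has_vector_derivative by fastforce
    then show ?thesis
      by (simp add: assms(2) P_def[abs_def] Complex_eq cis.ctr)
  qed
  have \<theta>_deriv: "(\<theta> has_real_derivative deriv \<theta> s) (at s)" for s
    using assms(7) unfolding smooth_def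
    by (metis funpow_0 DERIV_deriv_iff_real_differentiable)
  interpret unit_speed_curve P \<theta>
    by unfold_locales
      (use P_deriv DERIV_continuous_on[OF has_field_derivative_at_within[OF \<theta>_deriv]] in auto)
  have per: "P (s + L) = P s + of_real (2 * pi)" for s
    using assms(4,5) by (simp add: P_def complex_eq_iff)
  have short_loop: "\<exists>x y. x < y \<and> y \<le> x + (L - 2 * pi) \<and> P x = P y" if "\<not> inj p"
  proof -
    from that obtain s t where "P s = P t" "s \<noteq> t" by (auto simp: inj_def p_eq)
    then show ?thesis 
      using ex_short_loop[of L "2 * pi" s t, OF per assms(1)] pi_gt_zero by (metis mult_pos_pos zero_less_numeral)
  qed

  have "inj p" if inj: "\<forall>a. inj_on p {a..a + (L - 2 * pi)}"
  proof (rule ccontr)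
    assume "\<not> inj p"
    then obtain x y where xy: "x < y" "y \<le> x + (L - 2 * pi)" "P x = P y" using short_loop by blast
    then have "x = y" using inj_onD[OF spec[OF inj, of x], of x y] by (simp add: p_eq)
    then show False using xy(1) by simp
  qed
  moreover have "\<exists>s. \<bar>deriv \<theta> s\<bar> \<ge> 2 * pi / (L - 2 * pi)" if "\<not> inj p"
  proof -
    obtain x y where xy: "x < y" "y \<le> x + (L - 2 * pi)" "P x = P y" using short_loop \<open>\<not> inj p\<close> by blast
    obtain s where "\<bar>deriv \<theta> s\<bar> \<ge> 2 * pi / (y - x)"
      using loop_curvature[OF xy(3,1) \<theta>_deriv] by blast
    moreover have "2 * pi / (y - x) \<ge> 2 * pi / (L - 2 * pi)"
      by (rule divide_left_mono) (use xy in \<open>auto intro!: mult_pos_pos\<close>)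
    ultimately show ?thesis by (meson order_trans)
  qed
  moreover have "\<exists>a q1 q2. q1 \<noteq> q2 \<and>
      (\<exists>s1\<in>{a..a + L}. \<exists>t1\<in>{a..a + L}. s1 \<noteq> t1 \<and> p s1 = q1 \<and> p t1 = q1) \<and>
      (\<exists>s2\<in>{a..a + L}. \<exists>t2\<in>{a..a + L}. s2 \<noteq> t2 \<and> p s2 = q2 \<and> p t2 = q2)"
    if ninj: "\<not> inj p" and \<theta>_per: "\<forall>s. \<theta> (s + L) = \<theta> s"
  proof -
    obtain a b where ab: "a < b" "b \<le> a + (L - 2 * pi)" "P a = P b" using short_loop[OF ninj] by blast
    then have "b < a + L" using pi_gt_zero by linarith
    have "crossing p (p a)"
      unfolding crossing_def using ab by (metis p_eq less_irrefl)
    then obtain s1 s2 where s: "{s. p s = p a} = {s1, s2}"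
      "vector_derivative p (at s1) \<noteq> - vector_derivative p (at s2)"
      using assms(9) unfolding simple_crossing_def by metis
    have "a \<in> {s1, s2}" "b \<in> {s1, s2}" using ab(3) unfolding s(1)[symmetric] by (auto simp: p_eq)
    then have preimage: "{s. p s = p a} = {a, b}" and s12: "s1 = a \<and> s2 = b \<or> s1 = b \<and> s2 = a"
      using s(1) ab(1) by auto
    have "cis (\<theta> a) \<noteq> - cis (\<theta> b)"
      using s(2) s12 by (auto simp: assms(8) complex_eq_iff)
    then obtain x y where xy: "x < y" "P x = P y" "(x, y) \<noteq> (a, b)"
      and region: "a \<le> x \<and> y \<le> b \<or> b \<le> x \<and> y \<le> a + L \<or> x \<le> a \<and> b \<le> y \<and> y \<le> x + L"
      using ex_second_loop[of L "2 * pi" a b, OF assms(1) per] \<theta>_per ab(1,3) \<open>b < a + L\<close> by auto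
    \<comment> \<open>Otherwise x < y would both be among the two parameters a < b of this
      crossing.\<close>
    have distinct: "p a \<noteq> p x"
    proof
      assume "p a = p x"
      then have "x \<in> {s. p s = p a}" "y \<in> {s. p s = p a}" using xy(2) by (auto simp: p_eq)
      then show False using xy(1,3) ab(1) unfolding preimage by auto
    qed
    \<comment> \<open>The window starts at x when the second loop spans the first, and at a
      otherwise.\<close>
    define d where "d = min a x"
    have window: "a \<in> {d..d + L}" "b \<in> {d..d + L}" "x \<in> {d..d + L}" "y \<in> {d..d + L}"
      using region xy(1) ab(1) \<open>b < a + L\<close> by (auto simp: d_def min_def)
    have second: "\<exists>s\<in>{d..d + L}. \<exists>t\<in>{d..d + L}. s \<noteq> t \<and> p s = p x \<and> p t = p x"
      using window(3,4) xy(1,2) by (intro bexI[of _ x] bexI[of _ y]) (auto simp: p_eq)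
    have "\<exists>s\<in>{d..d + L}. \<exists>t\<in>{d..d + L}. s \<noteq> t \<and> p s = p a \<and> p t = p a"
      using window(1,2) ab(1,3) by (intro bexI[of _ a] bexI[of _ b]) (auto simp: p_eq)
    with distinct second show ?thesis by blast
  qed
  ultimately show ?thesis by blast
qed

end
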